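(* Let $\alpha,\beta>0$, $\rho:=\log_2(\alpha+\beta)$, and let $f$, $g$ be as described in the context (so $f(n)=\alpha f(\lfloor n/2\rfloor)+\beta f(\lceil n/2\rceil)+g(n)$ for $n\ge2$, with $f$, $g$ extended to real arguments $x\ge1$ by $\varphi$-interpolation). The following are equivalent. (i) $n^{-\rho}f(n)=P(\log_2 n)+o(1)$ as $n\to\infty$ (over the integers), for some continuous $1$-periodic function $P$ on $\mathbb{R}$. (ii) $x^{-\rho}f(x)=P(\log_2 x)+o(1)$ as $x\to\infty$ (over the reals), for some continuous $1$-periodic function $P$ on $\mathbb{R}$. (iii) $x^{-\rho}f(x)=P(\log_2 x)+o(1)$ as $x\to\infty$, for some $1$-periodic function $P$ on $\mathbb{R}$. (iv) The series $Q(x):=\sum_{m\ge1}2^{-\rho m}g(2^m x)$ converges uniformly for $x\in[1,2]$. Furthermore, when these conditions hold, $Q(x)$ is defined by this series for all $x>0$, $Q(x)=o(x^\rho)$ as $x\to\infty$, and $$f(x)=x^\rho P(\log_2 x)-Q(x),\qquad x\ge1,$$ where the continuous $1$-periodic function $P$ is given by $$P(t)=\sum_{m\in\mathbb{Z}}2^{-\rho(m+t)}g(2^{m+t})+f(1)P_0(t),\qquad t\in\mathbb{R}.$$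
   Context: Let $\alpha,\beta>0$ be real and $\rho:=\log_2(\alpha+\beta)$. Let $(f(n))_{n\ge1}$ and $(g(n))_{n\ge2}$ be real sequences with $f(1)$ arbitrary and $f(n)=\alpha f(\lfloor n/2\rfloor)+\beta f(\lceil n/2\rceil)+g(n)$ for $n\ge2$ (equivalently $f(2n)=(\alpha+\beta)f(n)+g(2n)$ and $f(2n+1)=\alpha f(n)+\beta f(n+1)+g(2n+1)$ for $n\ge1$); set $g(1):=0$. Let $\varphi=\varphi_{\alpha,\beta}:[0,1]\to[0,1]$ be the unique continuous function with $\varphi(0)=0$, $\varphi(1)=1$, $\varphi(t)=\frac{\beta}{\alpha+\beta}\varphi(2t)$ for $t\in[0,\frac12]$ and $\varphi(t)=\frac{\alpha}{\alpha+\beta}\varphi(2t-1)+\frac{\beta}{\alpha+\beta}$ for $t\in[\frac12,1]$. Extend $f$ and $g$ to real $x\ge1$ by $f(n+t):=(1-\varphi(t))f(n)+\varphi(t)f(n+1)$ and $g(n+t):=(1-\varphi(t))g(n)+\varphi(t)g(n+1)$ for integers $n\ge1$ and $t\in[0,1]$, and set $g(x):=0$ for $0\le x<1$. Write $\{t\}:=t-\lfloor t\rfloor$ and $$P_0(t):=\bigl(1+(\alpha+\beta-1)\varphi(2^{\{t\}}-1)\bigr)(\alpha+\beta)^{-\{t\}}.$$ *)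

theory Defs
  imports "HOL-Analysis.Analysis" "HOL-Library.Landau_Symbols"
begin

definition rho :: "real \<Rightarrow> real \<Rightarrow> real" where
  "rho \<alpha> \<beta> = log 2 (\<alpha> + \<beta>)"

text \<open>The value \<open>0\<close> outside \<open>[0,1]\<close> only serves to make the function unique as a total function
  on the reals; it is never used. Existence and uniqueness are shown in \<open>ex1_is_phi\<close> below.\<close>

definition is_phi :: "real \<Rightarrow> real \<Rightarrow> (real \<Rightarrow> real) \<Rightarrow> bool" where
  "is_phi \<alpha> \<beta> \<phi> \<longleftrightarrow>
     continuous_on {0..1} \<phi> \<and> \<phi> ` {0..1} \<subseteq> {0..1} \<and> \<phi> 0 = 0 \<and> \<phi> 1 = 1 \<and>
     (\<forall>t\<in>{0..1/2}. \<phi> t = \<beta> / (\<alpha> + \<beta>) * \<phi> (2 * t)) \<and>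
     (\<forall>t\<in>{1/2..1}. \<phi> t = \<alpha> / (\<alpha> + \<beta>) * \<phi> (2 * t - 1) + \<beta> / (\<alpha> + \<beta>)) \<and>
     (\<forall>t. t \<notin> {0..1} \<longrightarrow> \<phi> t = 0)"

definition phi :: "real \<Rightarrow> real \<Rightarrow> real \<Rightarrow> real" where
  "phi \<alpha> \<beta> = (THE \<phi>. is_phi \<alpha> \<beta> \<phi>)"

text \<open>Interpolation of a sequence \<open>h\<close>, indexed from \<open>1\<close>, to real \<open>x \<ge> 1\<close>; the values at \<open>x < 1\<close>
  are meaningless.\<close>

definition interp :: "real \<Rightarrow> real \<Rightarrow> (nat \<Rightarrow> real) \<Rightarrow> real \<Rightarrow> real" where
  "interp \<alpha> \<beta> h x =
     (1 - phi \<alpha> \<beta> (frac x)) * h (nat \<lfloor>x\<rfloor>) + phi \<alpha> \<beta> (frac x) * h (nat \<lfloor>x\<rfloor> + 1)"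

definition interp0 :: "real \<Rightarrow> real \<Rightarrow> (nat \<Rightarrow> real) \<Rightarrow> real \<Rightarrow> real" where
  "interp0 \<alpha> \<beta> g x = (if x < 1 then 0 else interp \<alpha> \<beta> g x)"

definition Q_term :: "real \<Rightarrow> real \<Rightarrow> (nat \<Rightarrow> real) \<Rightarrow> real \<Rightarrow> nat \<Rightarrow> real" where
  "Q_term \<alpha> \<beta> g x m = 2 powr (- rho \<alpha> \<beta> * real m) * interp0 \<alpha> \<beta> g (2 ^ m * x)"

definition Q :: "real \<Rightarrow> real \<Rightarrow> (nat \<Rightarrow> real) \<Rightarrow> real \<Rightarrow> real" where
  "Q \<alpha> \<beta> g x = (\<Sum>m. Q_term \<alpha> \<beta> g x (Suc m))"

definition P0 :: "real \<Rightarrow> real \<Rightarrow> real \<Rightarrow> real" where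
  "P0 \<alpha> \<beta> t =
     (1 + (\<alpha> + \<beta> - 1) * phi \<alpha> \<beta> (2 powr frac t - 1)) * (\<alpha> + \<beta>) powr (- frac t)"

text \<open>Convergence of a two-sided series means convergence of both one-sided series. Unordered
  summation (\<open>infsum\<close>) would be wrong here, since convergence need not be absolute.\<close>

definition bi_summable :: "(int \<Rightarrow> real) \<Rightarrow> bool" where
  "bi_summable a \<longleftrightarrow> summable (\<lambda>m. a (int m)) \<and> summable (\<lambda>m. a (- int (Suc m)))"

definition bi_suminf :: "(int \<Rightarrow> real) \<Rightarrow> real" where
  "bi_suminf a = (\<Sum>m. a (int m)) + (\<Sum>m. a (- int (Suc m)))"

definition P_term :: "real \<Rightarrow> real \<Rightarrow> (nat \<Rightarrow> real) \<Rightarrow> real \<Rightarrow> int \<Rightarrow> real" where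
  "P_term \<alpha> \<beta> g t m =
     2 powr (- rho \<alpha> \<beta> * (of_int m + t)) * interp0 \<alpha> \<beta> g (2 powr (of_int m + t))"

definition P_lim :: "real \<Rightarrow> real \<Rightarrow> (nat \<Rightarrow> real) \<Rightarrow> (nat \<Rightarrow> real) \<Rightarrow> real \<Rightarrow> real" where
  "P_lim \<alpha> \<beta> f g t = bi_suminf (P_term \<alpha> \<beta> g t) + f 1 * P0 \<alpha> \<beta> t"

definition periodic1 :: "(real \<Rightarrow> real) \<Rightarrow> bool" where
  "periodic1 P \<longleftrightarrow> (\<forall>t. P (t + 1) = P t)"

definition asymp_nat :: "real \<Rightarrow> real \<Rightarrow> (nat \<Rightarrow> real) \<Rightarrow> (real \<Rightarrow> real) \<Rightarrow> bool" where
  "asymp_nat \<alpha> \<beta> f P \<longleftrightarrow>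
     (\<lambda>n. real n powr (- rho \<alpha> \<beta>) * f n - P (log 2 (real n))) \<in> o(\<lambda>_. 1)"

definition asymp_real :: "real \<Rightarrow> real \<Rightarrow> (nat \<Rightarrow> real) \<Rightarrow> (real \<Rightarrow> real) \<Rightarrow> bool" where
  "asymp_real \<alpha> \<beta> f P \<longleftrightarrow>
     (\<lambda>x. x powr (- rho \<alpha> \<beta>) * interp \<alpha> \<beta> f x - P (log 2 x)) \<in> o[at_top](\<lambda>_. 1)"

lemma is_phi_unique:
  assumes pos: "\<alpha> > 0" "\<beta> > 0" and u: "is_phi \<alpha> \<beta> u" and v: "is_phi \<alpha> \<beta> v"
  shows "u = v"
proof -
  define c where "c = \<beta> / (\<alpha> + \<beta>)"
  define k where "k = max c (1 - c)"
  have c: "0 < c" "c < 1" and c': "\<alpha> / (\<alpha> + \<beta>) = 1 - c"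
    using pos by (auto simp: c_def field_simps)
  have k: "0 < k" "k < 1" "c \<le> k" "1 - c \<le> k" using c by (auto simp: k_def)
  define d where "d t = \<bar>u t - v t\<bar>" for t
  have "continuous_on {0..1} d"
    unfolding d_def using u v by (intro continuous_intros) (auto simp: is_phi_def)
  then obtain s where s: "s \<in> {0..1}" and max: "\<And>t. t \<in> {0..1} \<Longrightarrow> d t \<le> d s"
    using continuous_attains_sup[of "{0..1::real}" d] by auto
  have "d s \<le> k * d s"
  proof (cases "s \<le> 1/2")
    case True
    hence "s \<in> {0..1/2}" using s by auto
    hence "u s - v s = c * (u (2 * s) - v (2 * s))"
      using u v by (simp add: is_phi_def c_def algebra_simps)
    hence "d s = c * d (2 * s)" using c by (simp add: d_def abs_mult)
    also have "\<dots> \<le> k * d s" using k s True c max[of "2 * s"] by (intro mult_mono) (auto simp: d_def)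
    finally show ?thesis .
  next
    case False
    hence "s \<in> {1/2..1}" using s by auto
    hence "u s = (1 - c) * u (2 * s-1) + c" "v s = (1 - c) * v (2 * s-1) + c"
      using u v by (simp_all add: is_phi_def c' c_def[symmetric])
    hence "u s - v s = (1-c) * (u (2 * s-1) - v (2 * s-1))"
      by (simp add: algebra_simps)
    hence "d s = (1-c) * d (2 * s-1)" using c by (simp add: d_def abs_mult)
    also have "\<dots> \<le> k * d s" using k s False c max[of "2 * s-1"] by (intro mult_mono) (auto simp: d_def)
    finally show ?thesis .
  qed
  hence "(1 - k) * d s \<le> 0" by (simp add: algebra_simps)
  hence "d s \<le> 0" using k by (simp add: mult_le_0_iff)
  hence "d t = 0" if "t \<in> {0..1}" for t using max[OF that] by (simp add: d_def)
  moreover have "d t = 0" if "t \<notin> {0..1}" for t using that u v by (simp add: d_def is_phi_def)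
  ultimately have "d t = 0" for t by blast
  thus ?thesis by (simp add: d_def fun_eq_iff)
qed

lemma is_phi_exists:
  assumes pos: "\<alpha> > 0" "\<beta> > 0"
  shows "\<exists>\<phi>. is_phi \<alpha> \<beta> \<phi>"
proof -
  define c where "c = \<beta> / (\<alpha> + \<beta>)"
  define k where "k = max c (1 - c)"
  have c: "0 < c" "c < 1" and c': "\<alpha> / (\<alpha> + \<beta>) = 1 - c"
    using pos by (auto simp: c_def field_simps)
  have k: "0 \<le> k" "k < 1" "c \<le> k" "1 - c \<le> k" using c by (auto simp: k_def)
  define X where "X = (\<lambda>t::real. if t \<le> 0 then {0} else if t \<ge> 1 then {1} else {0..1::real})"
  define S where "S = PiC UNIV X"
  have S_iff: "w \<in> S \<longleftrightarrow> (\<forall>t. apply_bcontfun w t \<in> X t)" for w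
    by (auto simp: S_def mem_PiC_iff)
  have "closed S" unfolding S_def by (rule closed_PiC) (auto simp: X_def)
  hence cS: "complete S" by (simp add: complete_eq_closed)
  define T0 where "T0 w t = c * apply_bcontfun w (2 * t) + (1-c) * apply_bcontfun w (2 * t-1)"
    for w :: "real \<Rightarrow>\<^sub>C real" and t
  define T where "T w = Bcontfun (T0 w)" for w
  have X_le: "0 \<le> z" "z \<le> 1" if "z \<in> X t" for z t using that by (auto simp: X_def split: if_splits)
  have T0X: "T0 w t \<in> X t" if "w \<in> S" for w t
  proof -
    have 1: "apply_bcontfun w (2 * t) \<in> X (2 * t)" "apply_bcontfun w (2 * t-1) \<in> X (2 * t-1)"
      using that by (auto simp: S_iff)
    have "T0 w t \<le> c * 1 + (1-c) * 1" unfolding T0_def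
      using c X_le[OF 1(1)] X_le[OF 1(2)] by (intro add_mono mult_left_mono) auto
    moreover have "0 \<le> T0 w t" unfolding T0_def using c X_le[OF 1(1)] X_le[OF 1(2)] by simp
    ultimately show ?thesis using 1
      by (auto simp: X_def T0_def split: if_splits)
  qed
  have T: "apply_bcontfun (T w) = T0 w" if "w \<in> S" for w
  proof -
    have "continuous_on UNIV (T0 w)"
      unfolding T0_def
      by (intro continuous_intros continuous_on_compose2[OF continuous_on_apply_bcontfun[of UNIV w]]) auto
    moreover have "norm (T0 w t) \<le> 1" for t using X_le[OF T0X[OF that, of t]] by simp
    ultimately have "T0 w \<in> bcontfun" by (rule bcontfun_normI)
    thus ?thesis unfolding T_def by (rule Bcontfun_inverse)
  qed
  have TS: "T ` S \<subseteq> S" using T T0X by (auto simp: S_iff)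
  have lip: "dist (T v) (T w) \<le> k * dist v w" if vw: "v \<in> S" "w \<in> S" for v w
  proof (rule dist_bound)
    fix t
    have b: "\<bar>apply_bcontfun v z - apply_bcontfun w z\<bar> \<le> dist v w" for z
      using dist_bounded[of v z w] by (simp add: dist_real_def)
    have Z: "apply_bcontfun v z = apply_bcontfun w z" if "z \<le> 0 \<or> z \<ge> 1" for z
      using vw that unfolding S_iff X_def by (metis singletonD not_one_le_zero order_trans)
    show "dist (apply_bcontfun (T v) t) (apply_bcontfun (T w) t) \<le> k * dist v w"
    proof (cases "t \<le> 1/2")
      case True
      hence "dist (apply_bcontfun (T v) t) (apply_bcontfun (T w) t)
             = c * \<bar>apply_bcontfun v (2 * t) - apply_bcontfun w (2 * t)\<bar>"
        using T vw Z[of "2 * t-1"] c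
        by (simp add: T0_def dist_real_def right_diff_distrib[symmetric] abs_mult)
      also have "\<dots> \<le> k * dist v w" using b k c by (intro mult_mono) auto
      finally show ?thesis .
    next
      case False
      hence "dist (apply_bcontfun (T v) t) (apply_bcontfun (T w) t)
             = (1-c) * \<bar>apply_bcontfun v (2 * t-1) - apply_bcontfun w (2 * t-1)\<bar>"
        using T vw Z[of "2 * t"] c
        by (simp add: T0_def dist_real_def right_diff_distrib[symmetric] abs_mult)
      also have "\<dots> \<le> k * dist v w" using b k c by (intro mult_mono) auto
      finally show ?thesis .
    qed
  qed
  have "S \<noteq> {}"
  proof -
    have "(\<lambda>t::real. min 1 (max 0 t)) \<in> bcontfun"
      by (rule bcontfun_normI[of _ 1]) (auto intro!: continuous_intros)
    hence "Bcontfun (\<lambda>t::real. min 1 (max 0 t)) \<in> S"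
      by (auto simp: S_iff Bcontfun_inverse X_def)
    thus ?thesis by blast
  qed
  from Banach_fix[OF cS this k(1,2) TS] lip obtain w where w: "w \<in> S" "T w = w" by metis
  define p where "p = apply_bcontfun w"
  have fix_p: "p t = c * p (2 * t) + (1-c) * p (2 * t-1)" for t
    using T[OF w(1)] w(2) unfolding p_def T0_def by metis
  have pX: "p t \<in> X t" for t using w(1) by (simp add: S_iff p_def)
  have p0: "p t = 0" if "t \<le> 0" for t using pX[of t] that by (simp add: X_def)
  have p1: "p t = 1" if "t \<ge> 1" for t using pX[of t] that by (simp add: X_def)
  define q where "q t = (if t \<in> {0..1} then p t else 0)" for t
  have "is_phi \<alpha> \<beta> q"
    unfolding is_phi_def c' c_def[symmetric]
  proof (intro conjI ballI allI impI)
    show "continuous_on {0..1} q"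
      unfolding q_def p_def
      by (rule continuous_on_eq[OF continuous_on_apply_bcontfun[of "{0..1}" w]]) auto
    show "q ` {0..1} \<subseteq> {0..1}" using X_le[OF pX] by (auto simp: q_def)
    show "q 0 = 0" "q 1 = 1" using p0[of 0] p1[of 1] by (auto simp: q_def)
    show "q t = c * q (2 * t)" if "t \<in> {0..1/2}" for t
      using that fix_p[of t] p0[of "2 * t-1"] by (simp add: q_def)
    show "q t = (1 - c) * q (2 * t-1) + c" if "t \<in> {1/2..1}" for t
      using that fix_p[of t] p1[of "2 * t"] by (simp add: q_def)
    show "q t = 0" if "t \<notin> {0..1}" for t using that unfolding q_def by (rule if_not_P)
  qed
  thus ?thesis by blast
qed

lemma ex1_is_phi: "\<alpha> > 0 \<Longrightarrow> \<beta> > 0 \<Longrightarrow> \<exists>!\<phi>. is_phi \<alpha> \<beta> \<phi>"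
  using is_phi_exists is_phi_unique by blast

end

theory Submission
  imports Defs
begin

text \<open>
  The functional equations of \<open>\<phi>\<close> are exactly what makes the recurrence survive interpolation:
  \<open>f(2x) = (\<alpha>+\<beta>) f(x) + g(2x)\<close> for all real \<open>x \<ge> 1\<close>. Iterating, \<open>(\<alpha>+\<beta>)\<^sup>-\<^sup>N f(2\<^sup>N x)\<close> is \<open>f(x)\<close> plus
  the \<open>N\<close>-th partial sum of \<open>Q(x)\<close>. For periodic \<open>P\<close>, the asymptotic relation over the reals
  says precisely that these rescaled functions converge uniformly on \<open>[1,2]\<close> to
  \<open>x\<^sup>\<rho> P(log\<^sub>2 x)\<close>; hence it is equivalent to uniform convergence of \<open>Q\<close>, it forces \<open>P\<close> to be
  continuous, and it determines \<open>P\<close> from \<open>f + Q\<close>, which satisfies the homogeneous equation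
  \<open>h(2x) = (\<alpha>+\<beta>) h(x)\<close>. Over the integers, uniform continuity of \<open>P\<close> lets the relation pass to the
  convex combination that defines \<open>f(x)\<close>.
\<close>

section \<open>Periodic functions\<close>

text \<open>Adjacent closed pieces overlap in an integer, so they glue to
  \<open>[n - 1, n + 1]\<close>, whose interior contains every point with floor \<open>n\<close>.
  This serves both interpolated sequences and periodic functions.\<close>

lemma continuous_on_UNIV_if_unit_intervals:
  fixes h :: "real \<Rightarrow> real"
  assumes "\<And>n::int. continuous_on {of_int n..of_int n + 1} h"
  shows "continuous_on UNIV h"
proof (rule continuous_at_imp_continuous_on, rule ballI)
  fix t :: real
  define n where "n = \<lfloor>t\<rfloor>"
  have "continuous_on ({of_int (n - 1)..of_int (n - 1) + 1} \<union> {of_int n..of_int n + 1}) h"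
    by (intro continuous_on_closed_Un assms) auto
  also have "{of_int (n - 1)..of_int (n - 1) + 1} \<union> {of_int n..of_int n + 1}
      = {of_int n - 1..of_int n + (1::real)}"
    by auto
  finally have c: "continuous_on {of_int n - 1..of_int n + (1::real)} h" .
  have "of_int n \<le> t" "t < of_int n + 1"
    unfolding n_def by linarith+
  then have "t \<in> interior {of_int n - 1..of_int n + (1::real)}"
    by (simp add: interior_atLeastAtMost_real)
  with c show "isCont h t"
    by (rule continuous_on_interior)
qed

lemma periodic1_add_nat:
  assumes "periodic1 P"
  shows "P (t + real n) = P t"
proof (induction n)
  case (Suc n)
  have "P (t + real (Suc n)) = P ((t + real n) + 1)"
    by (simp add: algebra_simps)
  with Suc assms show ?case
    by (simp add: periodic1_def)
qed simp

lemma periodic1_add_int: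
  assumes "periodic1 P"
  shows "P (t + of_int k) = P t"
proof (cases "k \<ge> 0")
  case True
  then show ?thesis
    using periodic1_add_nat[OF assms, of t "nat k"] by simp
next
  case False
  then show ?thesis
    using periodic1_add_nat[OF assms, of "t + of_int k" "nat (- k)"] by simp
qed

lemma periodic1_frac:
  assumes "periodic1 P"
  shows "P (frac t) = P t"
  using periodic1_add_int[OF assms, of "frac t" "\<lfloor>t\<rfloor>"] by (simp add: frac_def)

lemma periodic1_continuous_on_UNIV:
  assumes "periodic1 P" and "continuous_on {0..1} P"
  shows "continuous_on UNIV P"
proof (rule continuous_on_UNIV_if_unit_intervals)
  fix n :: int
  have "continuous_on {of_int n..of_int n + 1} (\<lambda>t. P (t + of_int (- n)))"
    by (rule continuous_on_compose2[OF assms(2)]) (auto intro!: continuous_intros)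
  then show "continuous_on {of_int n..of_int n + 1} P"
    unfolding periodic1_add_int[OF assms(1)] .
qed

text \<open>Compactness gives a modulus on \<open>[-1, 2]\<close>; an integer shift brings
  \<open>u\<close> into \<open>[0, 1)\<close> together with any \<open>v\<close> nearby.\<close>

lemma periodic1_uniformly_continuous:
  assumes "periodic1 P" and "continuous_on UNIV P"
  shows "uniformly_continuous_on UNIV P"
  unfolding uniformly_continuous_on_def
proof (intro allI impI)
  fix e :: real
  assume "0 < e"
  have "uniformly_continuous_on {-1..2} P"
    by (intro compact_uniformly_continuous continuous_on_subset[OF assms(2)]) auto
  with \<open>0 < e\<close> obtain d where d: "d > 0"
    "\<And>u v. u \<in> {-1..2} \<Longrightarrow> v \<in> {-1..2} \<Longrightarrow> dist v u < d \<Longrightarrow> dist (P v) (P u) < e"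
    unfolding uniformly_continuous_on_def by metis
  \<comment> \<open>The cap at 1 keeps the shifted \<open>v\<close> inside
    \<open>[-1, 2]\<close>.\<close>
  have "dist (P v) (P u) < e" if "dist v u < min d 1" for u v
  proof -
    define k where "k = - \<lfloor>u\<rfloor>"
    have "0 \<le> u + of_int k" "u + of_int k < 1"
      unfolding k_def by linarith+
    then have "dist (P (v + of_int k)) (P (u + of_int k)) < e"
      using that by (intro d(2)) (auto simp: dist_real_def)
    then show ?thesis
      by (simp add: periodic1_add_int[OF assms(1)])
  qed
  with d(1) show "\<exists>d>0. \<forall>x\<in>UNIV. \<forall>x'\<in>UNIV. dist x' x < d \<longrightarrow> dist (P x') (P x) < e"
    by (intro exI[of _ "min d 1"]) auto
qed

lemma periodic1_bounded:
  assumes "periodic1 P" and "continuous_on UNIV P"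
  obtains B where "\<And>t. \<bar>P t\<bar> \<le> B"
proof -
  have "bounded (P ` {0..1})"
    by (intro compact_imp_bounded compact_continuous_image continuous_on_subset[OF assms(2)]) auto
  then obtain B where B: "\<forall>y\<in>P ` {0..1}. norm y \<le> B"
    unfolding bounded_iff by blast
  have "\<bar>P t\<bar> \<le> B" for t
    using bspec[OF B imageI, of "frac t"] frac_lt_1[of t]
    by (simp add: periodic1_frac[OF assms(1)])
  then show thesis
    by (rule that)
qed

section \<open>Two-sided series\<close>

text \<open>The shift merely moves the term \<open>a 0\<close> from the nonnegative half to the
  negative half, so convergence of each half suffices and nothing is rearranged.\<close>

lemma bi_suminf_shift:
  assumes "bi_summable a"
  shows "bi_suminf (\<lambda>m. a (m + 1)) = bi_suminf a"
proof -
  have "(\<Sum>m. a (int (Suc m))) = (\<Sum>m. a (int m)) - a 0"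
    using suminf_split_head[of "\<lambda>m. a (int m)"] assms by (simp add: bi_summable_def)
  moreover have "(\<Sum>m. a (- int (Suc m))) = (\<Sum>m. a (- int m)) - a 0"
    using suminf_split_head[of "\<lambda>m. a (- int m)"] assms
      summable_Suc_iff[of "\<lambda>m. a (- int m)"]
    by (simp add: bi_summable_def)
  moreover have "- int (Suc m) + 1 = - int m" for m
    by simp
  ultimately show ?thesis
    by (simp add: bi_suminf_def add.commute)
qed

section \<open>Dyadic scaling\<close>

text \<open>The last conclusion restates \<open>y < 2\<close> in the form that forces
  \<open>N\<close> to be large when \<open>x\<close> is large.\<close>

lemma dyadic_decomp_ge1:
  fixes x :: real
  assumes "x \<ge> 1"
  obtains N :: nat and y :: real where "x = 2 ^ N * y" "1 \<le> y" "y < 2" "2 ^ Suc N > x"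
proof -
  define N where "N = nat \<lfloor>log 2 x\<rfloor>"
  have "log 2 x \<ge> 0"
    using assms by simp
  then have "real N \<le> log 2 x" "log 2 x < real (Suc N)"
    unfolding N_def by linarith+
  then have "2 powr real N \<le> x" "x < 2 powr real (Suc N)"
    using assms by (simp_all only: le_log_iff log_less_iff)
  then have "2 ^ N \<le> x" "x < 2 ^ Suc N"
    by (simp_all only: powr_realpow zero_less_numeral)
  then show thesis
    by (intro that[of N "x / 2 ^ N"]) (auto simp: field_simps)
qed

lemma dyadic_decomp_lt1:
  fixes x :: real
  assumes "0 < x" "x < 1"
  obtains N :: nat and y :: real where "y = 2 ^ N * x" "1 \<le> y" "y < 2"
proof -
  define N where "N = nat (- \<lfloor>log 2 x\<rfloor>)"
  have "log 2 x < 0"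
    using assms by simp
  then have "real N = - of_int \<lfloor>log 2 x\<rfloor>"
    unfolding N_def by simp
  then have "- real N \<le> log 2 x" "log 2 x < - real N + 1"
    by linarith+
  then have "2 powr (- real N) \<le> x" "x < 2 powr (- real N + 1)"
    using assms by (simp_all only: le_log_iff log_less_iff)
  moreover have "2 powr (- real N) = 1 / 2 ^ N" "2 powr (- real N + 1) = 2 / 2 ^ N"
    by (simp_all only: powr_add powr_minus) (simp_all add: powr_realpow divide_inverse)
  ultimately have "1 / 2 ^ N \<le> x" "x < 2 / 2 ^ N"
    by (simp_all only:)
  then have "1 \<le> 2 ^ N * x" "2 ^ N * x < 2"
    by (simp_all add: field_simps)
  then show thesis
    by (intro that) auto
qed

lemma log2_scaled: "x > 0 \<Longrightarrow> log 2 (2 ^ N * x) = log 2 x + real N"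
  by (simp add: log_mult log_nat_power)

lemma asymp_real_iff_tendsto:
  "asymp_real \<alpha> \<beta> f P \<longleftrightarrow>
     ((\<lambda>x. x powr (- rho \<alpha> \<beta>) * interp \<alpha> \<beta> f x - P (log 2 x)) \<longlongrightarrow> 0) at_top"
  unfolding asymp_real_def
  by (auto intro!: smalloI_tendsto dest!: smalloD_tendsto)

lemma asymp_nat_iff_tendsto:
  "asymp_nat \<alpha> \<beta> f P \<longleftrightarrow>
     (\<lambda>n. real n powr (- rho \<alpha> \<beta>) * f n - P (log 2 (real n))) \<longlonglongrightarrow> 0"
  unfolding asymp_nat_def
  by (auto intro!: smalloI_tendsto dest!: smalloD_tendsto)

section \<open>Interpolation\<close>

context
  fixes \<alpha> \<beta> :: real
  assumes \<alpha>_pos: "\<alpha> > 0" and \<beta>_pos: "\<beta> > 0"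
begin

lemma is_phi_phi: "is_phi \<alpha> \<beta> (phi \<alpha> \<beta>)"
  unfolding phi_def by (rule theI'[OF ex1_is_phi[OF \<alpha>_pos \<beta>_pos]])

lemma phi_0: "phi \<alpha> \<beta> 0 = 0" and phi_1: "phi \<alpha> \<beta> 1 = 1"
  using is_phi_phi by (auto simp: is_phi_def)

lemma phi_bounds: "t \<in> {0..1} \<Longrightarrow> 0 \<le> phi \<alpha> \<beta> t \<and> phi \<alpha> \<beta> t \<le> 1"
  using is_phi_phi by (auto simp: is_phi_def image_subset_iff)

lemma phi_lower_half: "t \<in> {0..1/2} \<Longrightarrow> (\<alpha> + \<beta>) * phi \<alpha> \<beta> t = \<beta> * phi \<alpha> \<beta> (2 * t)"
  using is_phi_phi \<alpha>_pos \<beta>_pos by (simp add: is_phi_def)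

lemma phi_upper_half:
  assumes "t \<in> {1/2..1}"
  shows "(\<alpha> + \<beta>) * phi \<alpha> \<beta> t = \<alpha> * phi \<alpha> \<beta> (2 * t - 1) + \<beta>"
proof -
  have "phi \<alpha> \<beta> t = (\<alpha> * phi \<alpha> \<beta> (2 * t - 1) + \<beta>) / (\<alpha> + \<beta>)"
    using is_phi_phi assms by (simp add: is_phi_def add_divide_distrib)
  then show ?thesis
    using \<alpha>_pos \<beta>_pos by simp
qed

text \<open>The endpoint \<open>t = 1\<close> is included: there the floor jumps, but
  \<open>phi\<close> taking the values 0 and 1 at the ends makes both formulas give
  \<open>h (Suc n)\<close>. Closed intervals are what the gluing argument and the doubling of
  arguments require.\<close>

lemma interp_add:
  assumes "t \<in> {0..1}"
  shows "interp \<alpha> \<beta> h (real n + t) = (1 - phi \<alpha> \<beta> t) * h n + phi \<alpha> \<beta> t * h (Suc n)"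
proof (cases "t = 1")
  case True
  have e: "real n + 1 = of_int (int n + 1)"
    by simp
  show ?thesis
    unfolding True interp_def e floor_of_int frac_of_int by (simp add: phi_0 phi_1 nat_add_distrib)
next
  case False
  with assms have "\<lfloor>real n + t\<rfloor> = int n"
    by (intro floor_unique) auto
  then show ?thesis
    by (simp add: interp_def frac_def)
qed

lemma interp_of_nat: "interp \<alpha> \<beta> h (real n) = h n"
  using interp_add[of 0 h n] by (simp add: phi_0)

lemma continuous_on_interp: "continuous_on {0..} (interp \<alpha> \<beta> h)"
proof -
  \<comment> \<open>Clamping at 0 extends the function continuously to the whole line, where the
    gluing lemma applies.\<close>
  have "continuous_on UNIV (\<lambda>x. interp \<alpha> \<beta> h (max 0 x))"
  proof (rule continuous_on_UNIV_if_unit_intervals)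
    fix k :: int
    show "continuous_on {of_int k..of_int k + 1} (\<lambda>x. interp \<alpha> \<beta> h (max 0 x))"
    proof (cases "k \<ge> 0")
      case True
      define n where "n = nat k"
      have n: "of_int k = real n"
        using True by (simp add: n_def)
      have "continuous_on {0..1} (phi \<alpha> \<beta>)"
        using is_phi_phi by (simp add: is_phi_def)
      then have "continuous_on {real n..real n + 1} (\<lambda>x. phi \<alpha> \<beta> (x - real n))"
        by (rule continuous_on_compose2) (auto intro!: continuous_intros)
      then have c: "continuous_on {real n..real n + 1}
          (\<lambda>x. (1 - phi \<alpha> \<beta> (x - real n)) * h n + phi \<alpha> \<beta> (x - real n) * h (Suc n))"
        by (intro continuous_intros)
      show ?thesis
        unfolding n
      proof (rule continuous_on_eq[OF c])
        fix x
        assume "x \<in> {real n..real n + 1}"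
        then show "(1 - phi \<alpha> \<beta> (x - real n)) * h n + phi \<alpha> \<beta> (x - real n) * h (Suc n)
            = interp \<alpha> \<beta> h (max 0 x)"
          using interp_add[of "x - real n" h n] by simp
      qed
    next
      case False
      then have "of_int k + 1 \<le> (0::real)"
        by linarith
      then have "max 0 x = 0" if "x \<in> {of_int k..of_int k + 1}" for x :: real
        using that by auto
      then show ?thesis
        by (intro continuous_on_eq[OF continuous_on_const[of _ "interp \<alpha> \<beta> h 0"]]) simp
    qed
  qed
  then have "continuous_on {0..} (\<lambda>x. interp \<alpha> \<beta> h (max 0 x))"
    by (rule continuous_on_subset) simp
  then show ?thesis
    by (rule continuous_on_eq) auto
qed

section \<open>Powers with exponent \<open>rho\<close>\<close>

lemma two_powr_rho: "2 powr rho \<alpha> \<beta> = \<alpha> + \<beta>"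
  using \<alpha>_pos \<beta>_pos by (simp add: rho_def)

lemma two_powr_rho_of_nat: "2 powr (- rho \<alpha> \<beta> * real m) = 1 / (\<alpha> + \<beta>) ^ m"
proof -
  have "2 powr (- rho \<alpha> \<beta> * real m) = (2 powr rho \<alpha> \<beta>) powr (- real m)"
    by (simp add: powr_powr)
  also have "\<dots> = 1 / (\<alpha> + \<beta>) ^ m"
    using \<alpha>_pos \<beta>_pos by (simp add: two_powr_rho powr_minus powr_realpow divide_inverse)
  finally show ?thesis .
qed

lemma scaled_powr_rho:
  assumes "x > 0"
  shows "(2 ^ N * x) powr rho \<alpha> \<beta> = (\<alpha> + \<beta>) ^ N * x powr rho \<alpha> \<beta>"
proof -
  have "(2 ^ N) powr rho \<alpha> \<beta> = (2 powr rho \<alpha> \<beta>) powr real N"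
    by (simp add: powr_powr powr_realpow[symmetric] mult.commute)
  then show ?thesis
    using assms \<alpha>_pos \<beta>_pos by (simp add: powr_mult two_powr_rho powr_realpow)
qed

text \<open>The sign of \<open>rho\<close> is unknown, since \<alpha> + \<beta> may be less than 1.
  By monotonicity a power of \<open>x\<close> is at most the larger of its values at 1 and 2, hence
  at most their sum. Together the bounds keep \<open>x powr rho\<close> away from 0 and infinity on
  \<open>[1,2]\<close>.\<close>

lemma powr_rho_bounds:
  assumes "x \<in> {1..2}"
  shows "x powr rho \<alpha> \<beta> \<le> 1 + (\<alpha> + \<beta>)" and "x powr - rho \<alpha> \<beta> \<le> 1 + 1 / (\<alpha> + \<beta>)"
proof -
  have *: "x powr a \<le> 1 + 2 powr a" for a :: real
  proof (cases "a \<ge> 0")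
    case True
    then have "x powr a \<le> 2 powr a"
      using assms by (intro powr_mono2) auto
    then show ?thesis
      by simp
  next
    case False
    then have "x powr a \<le> 1 powr a"
      using assms by (intro powr_mono2') auto
    then show ?thesis
      by (simp add: add_increasing2)
  qed
  show "x powr rho \<alpha> \<beta> \<le> 1 + (\<alpha> + \<beta>)" "x powr - rho \<alpha> \<beta> \<le> 1 + 1 / (\<alpha> + \<beta>)"
    using *[of "rho \<alpha> \<beta>"] *[of "- rho \<alpha> \<beta>"]
    by (simp_all add: powr_minus two_powr_rho divide_inverse)
qed

section \<open>Asymptotics\<close>

lemma asymp_real_imp_asymp_nat:
  assumes "asymp_real \<alpha> \<beta> f P"
  shows "asymp_nat \<alpha> \<beta> f P"
  using filterlim_compose[OF assms[unfolded asymp_real_iff_tendsto] filterlim_real_sequentially]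
  by (simp add: asymp_nat_iff_tendsto interp_of_nat)

text \<open>Evaluating \<open>f\<close> at an integer \<open>k x\<close> near \<open>x\<close> costs
  three errors: \<open>a\<close> is the hypothesis taken along \<open>k\<close>; \<open>b\<close>
  compares \<open>P\<close> at two points whose distance tends to 0, so uniform continuity applies;
  and the factor \<open>c\<close>, which changes the normalising power, tends to 1 while
  \<open>P\<close> is bounded.\<close>

lemma asymp_nat_along:
  fixes k :: "real \<Rightarrow> nat"
  assumes P: "periodic1 P" "continuous_on UNIV P" and f: "asymp_nat \<alpha> \<beta> f P"
    and k: "filterlim k at_top at_top" and lim: "((\<lambda>x. real (k x) / x) \<longlongrightarrow> 1) at_top"
  shows "((\<lambda>x. x powr (- rho \<alpha> \<beta>) * f (k x) - P (log 2 x)) \<longlongrightarrow> 0) at_top"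
proof -
  obtain B where B: "\<And>t. \<bar>P t\<bar> \<le> B"
    using periodic1_bounded[OF P] by blast
  define c where "c x = (real (k x) / x) powr rho \<alpha> \<beta>" for x
  define a where "a x = real (k x) powr (- rho \<alpha> \<beta>) * f (k x) - P (log 2 (real (k x)))" for x
  define b where "b x = P (log 2 (real (k x))) - P (log 2 x)" for x
  have ev: "\<forall>\<^sub>F x in at_top. x > 0 \<and> k x > 0"
    using eventually_conj[OF eventually_gt_at_top[of "0::real"]
        k[unfolded filterlim_at_top, rule_format, of 1]]
    by eventually_elim simp
  have c: "(c \<longlongrightarrow> 1) at_top"
    unfolding c_def using tendsto_powr[OF lim tendsto_const[of "rho \<alpha> \<beta>"]] by simp
  have a: "(a \<longlongrightarrow> 0) at_top"
    unfolding a_def using filterlim_compose[OF f[unfolded asymp_nat_iff_tendsto] k] .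
  have b: "(b \<longlongrightarrow> 0) at_top"
  proof (rule tendstoI)
    fix e :: real
    assume "e > 0"
    then obtain d where d: "d > 0" "\<And>u v. dist v u < d \<Longrightarrow> dist (P v) (P u) < e"
      using periodic1_uniformly_continuous[OF P] unfolding uniformly_continuous_on_def by auto
    have "((\<lambda>x. log 2 (real (k x) / x)) \<longlongrightarrow> log 2 1) at_top"
      by (intro tendsto_intros lim) auto
    then have "\<forall>\<^sub>F x in at_top. dist (log 2 (real (k x) / x)) (log 2 1) < d"
      by (rule tendstoD) (rule d(1))
    with ev show "\<forall>\<^sub>F x in at_top. dist (b x) 0 < e"
    proof eventually_elim
      case (elim x)
      then have "dist (log 2 (real (k x))) (log 2 x) < d"
        by (simp add: log_divide dist_real_def)
      then show ?case
        using d(2) by (simp add: b_def dist_real_def)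
    qed
  qed
  have Pc: "((\<lambda>x. P (log 2 x) * (c x - 1)) \<longlongrightarrow> 0) at_top"
  proof (rule Lim_null_comparison)
    show "\<forall>\<^sub>F x in at_top. norm (P (log 2 x) * (c x - 1)) \<le> B * \<bar>c x - 1\<bar>"
      by (intro always_eventually) (simp add: abs_mult mult_right_mono B)
    show "((\<lambda>x. B * \<bar>c x - 1\<bar>) \<longlongrightarrow> 0) at_top"
      using tendsto_mult_right_zero[OF tendsto_rabs_zero[OF Lim_null[THEN iffD1, OF c]], of B]
      by simp
  qed
  have "((\<lambda>x. c x * a x + c x * b x + P (log 2 x) * (c x - 1)) \<longlongrightarrow> 1 * 0 + 1 * 0 + 0) at_top"
    by (intro tendsto_intros a b c Pc)
  moreover have "\<forall>\<^sub>F x in at_top. c x * a x + c x * b x + P (log 2 x) * (c x - 1)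
      = x powr (- rho \<alpha> \<beta>) * f (k x) - P (log 2 x)"
    using ev
  proof eventually_elim
    case (elim x)
    have "c x * real (k x) powr (- rho \<alpha> \<beta>) = x powr (- rho \<alpha> \<beta>)"
      using elim by (simp add: c_def powr_divide powr_minus field_simps)
    then have "x powr (- rho \<alpha> \<beta>) * f (k x) = c x * (real (k x) powr (- rho \<alpha> \<beta>) * f (k x))"
      by (simp only: mult.assoc[symmetric])
    then show ?case
      unfolding a_def b_def by (simp only: right_diff_distrib) simp
  qed
  ultimately show ?thesis
    by (simp add: tendsto_cong)
qed

text \<open>The weights in \<open>interp\<close> lie in \<open>[0,1]\<close> and sum to 1, so the
  error at \<open>x\<close> is the same convex combination of the errors \<open>r 0\<close> and
  \<open>r 1\<close> made by the two neighbouring integers.\<close>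

lemma asymp_nat_imp_asymp_real:
  assumes P: "periodic1 P" "continuous_on UNIV P" and f: "asymp_nat \<alpha> \<beta> f P"
  shows "asymp_real \<alpha> \<beta> f P"
proof -
  define r where "r j x = x powr (- rho \<alpha> \<beta>) * f (nat \<lfloor>x\<rfloor> + j) - P (log 2 x)" for j x
  define w where "w x = phi \<alpha> \<beta> (frac x)" for x
  have w: "0 \<le> w x" "w x \<le> 1" for x
    using phi_bounds[of "frac x"] frac_lt_1[of x] by (auto simp: w_def)
  have r: "(r j \<longlongrightarrow> 0) at_top" for j
    unfolding r_def
  proof (rule asymp_nat_along[OF P f])
    show "filterlim (\<lambda>x::real. nat \<lfloor>x\<rfloor> + j) at_top at_top"
      unfolding filterlim_at_top
    proof
      fix Z :: nat
      show "\<forall>\<^sub>F x::real in at_top. Z \<le> nat \<lfloor>x\<rfloor> + j"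
        using eventually_ge_at_top[of "real Z"] by eventually_elim linarith
    qed
    have "((\<lambda>x::real. (1 + real j) / x) \<longlongrightarrow> 0) at_top"
      by (intro tendsto_divide_0[OF tendsto_const] filterlim_at_top_imp_at_infinity filterlim_ident)
    then have "((\<lambda>x. real (nat \<lfloor>x\<rfloor> + j) / x - 1) \<longlongrightarrow> 0) at_top"
    proof (rule Lim_null_comparison[rotated])
      show "\<forall>\<^sub>F x in at_top. norm (real (nat \<lfloor>x\<rfloor> + j) / x - 1) \<le> (1 + real j) / x"
        using eventually_ge_at_top[of "1::real"]
      proof eventually_elim
        case (elim x)
        have "\<bar>real (nat \<lfloor>x\<rfloor> + j) - x\<bar> \<le> 1 + real j"
          using elim by linarith
        moreover have "real (nat \<lfloor>x\<rfloor> + j) / x - 1 = (real (nat \<lfloor>x\<rfloor> + j) - x) / x"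
          using elim by (simp add: field_simps)
        ultimately show ?case
          using elim by (simp add: divide_right_mono)
      qed
    qed
    then show "((\<lambda>x. real (nat \<lfloor>x\<rfloor> + j) / x) \<longlongrightarrow> 1) at_top"
      by (rule Lim_null[THEN iffD2])
  qed
  have "((\<lambda>x. (1 - w x) * r 0 x + w x * r 1 x) \<longlongrightarrow> 0) at_top"
  proof (rule Lim_null_comparison)
    have "\<bar>(1 - w x) * r 0 x + w x * r 1 x\<bar> \<le> \<bar>r 0 x\<bar> + \<bar>r 1 x\<bar>" for x
    proof -
      have "\<bar>(1 - w x) * r 0 x\<bar> \<le> 1 * \<bar>r 0 x\<bar>" "\<bar>w x * r 1 x\<bar> \<le> 1 * \<bar>r 1 x\<bar>"
        unfolding abs_mult using w[of x] by (intro mult_right_mono; simp)+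
      then show ?thesis
        by linarith
    qed
    then show "\<forall>\<^sub>F x in at_top. norm ((1 - w x) * r 0 x + w x * r 1 x) \<le> \<bar>r 0 x\<bar> + \<bar>r 1 x\<bar>"
      by simp
    show "((\<lambda>x. \<bar>r 0 x\<bar> + \<bar>r 1 x\<bar>) \<longlongrightarrow> 0) at_top"
      using tendsto_add_zero[OF tendsto_rabs_zero tendsto_rabs_zero] r by blast
  qed
  moreover have "(1 - w x) * r 0 x + w x * r 1 x
      = x powr (- rho \<alpha> \<beta>) * interp \<alpha> \<beta> f x - P (log 2 x)" for x
    by (simp add: r_def w_def interp_def algebra_simps)
  ultimately show ?thesis
    by (simp add: asymp_real_iff_tendsto)
qed

text \<open>Periodicity of \<open>P\<close> and \<open>2 powr rho\<close> being \<alpha> + \<beta>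
  turn the difference on the right into \<open>x powr rho\<close> times the error \<open>R\<close>
  at \<open>2 ^ N * x\<close>. That factor is bounded above and below on \<open>[1,2]\<close>, and
  each large real is a large power of 2 times a point of \<open>[1,2]\<close>.\<close>

lemma asymp_real_iff_uniform_limit:
  assumes P: "periodic1 P"
  shows "asymp_real \<alpha> \<beta> f P \<longleftrightarrow>
    uniform_limit {1..2} (\<lambda>N x. interp \<alpha> \<beta> f (2 ^ N * x) / (\<alpha> + \<beta>) ^ N)
      (\<lambda>x. x powr rho \<alpha> \<beta> * P (log 2 x)) sequentially"
proof -
  define R where "R x = x powr (- rho \<alpha> \<beta>) * interp \<alpha> \<beta> f x - P (log 2 x)" for x
  have s: "\<alpha> + \<beta> > 0"
    using \<alpha>_pos \<beta>_pos by simp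
  have eq: "interp \<alpha> \<beta> f (2 ^ N * x) / (\<alpha> + \<beta>) ^ N - x powr rho \<alpha> \<beta> * P (log 2 x)
      = x powr rho \<alpha> \<beta> * R (2 ^ N * x)" if "x > 0" for N x
    unfolding R_def powr_minus scaled_powr_rho[OF that] log2_scaled[OF that]
      periodic1_add_nat[OF P]
    using that s by (simp add: field_simps)
  show ?thesis
  proof
    assume "asymp_real \<alpha> \<beta> f P"
    then have R: "(R \<longlongrightarrow> 0) at_top"
      unfolding asymp_real_iff_tendsto R_def .
    show "uniform_limit {1..2} (\<lambda>N x. interp \<alpha> \<beta> f (2 ^ N * x) / (\<alpha> + \<beta>) ^ N)
      (\<lambda>x. x powr rho \<alpha> \<beta> * P (log 2 x)) sequentially"
    proof (rule uniform_limitI)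
      fix e :: real
      assume "e > 0"
      then have "e / (1 + (\<alpha> + \<beta>)) > 0"
        using s by simp
      from tendstoD[OF R this] obtain X where
        X: "\<And>x. x \<ge> X \<Longrightarrow> \<bar>R x\<bar> < e / (1 + (\<alpha> + \<beta>))"
        by (auto simp: eventually_at_top_linorder)
      have "filterlim (\<lambda>N. 2 ^ N :: real) at_top sequentially"
        by (rule filterlim_at_infinity_imp_filterlim_at_top[OF filterlim_realpow_sequentially_gt1]) auto
      then have "\<forall>\<^sub>F N in sequentially. 2 ^ N \<ge> X"
        by (simp add: filterlim_at_top)
      then show "\<forall>\<^sub>F N in sequentially. \<forall>x\<in>{1..2}.
          dist (interp \<alpha> \<beta> f (2 ^ N * x) / (\<alpha> + \<beta>) ^ N) (x powr rho \<alpha> \<beta> * P (log 2 x)) < e"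
      proof eventually_elim
        case (elim N)
        show ?case
        proof
          fix x :: real
          assume x: "x \<in> {1..2}"
          \<comment> \<open>One threshold for \<open>N\<close> serves all \<open>x\<close> in
            \<open>[1,2]\<close>, since \<open>2 ^ N\<close> alone already exceeds
            \<open>X\<close>.\<close>
          have "2 ^ N * 1 \<le> 2 ^ N * x"
            using x by (intro mult_left_mono) auto
          with elim have "\<bar>R (2 ^ N * x)\<bar> < e / (1 + (\<alpha> + \<beta>))"
            by (intro X) linarith
          then have "x powr rho \<alpha> \<beta> * \<bar>R (2 ^ N * x)\<bar> < (1 + (\<alpha> + \<beta>)) * (e / (1 + (\<alpha> + \<beta>)))"
            using powr_rho_bounds(1)[OF x] x s by (intro mult_le_less_imp_less) auto
          also have "\<dots> = e"
            using s by simp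
          finally show "dist (interp \<alpha> \<beta> f (2 ^ N * x) / (\<alpha> + \<beta>) ^ N)
              (x powr rho \<alpha> \<beta> * P (log 2 x)) < e"
            using x by (simp add: dist_real_def eq abs_mult)
        qed
      qed
    qed
  next
    assume U: "uniform_limit {1..2} (\<lambda>N x. interp \<alpha> \<beta> f (2 ^ N * x) / (\<alpha> + \<beta>) ^ N)
      (\<lambda>x. x powr rho \<alpha> \<beta> * P (log 2 x)) sequentially"
    show "asymp_real \<alpha> \<beta> f P"
      unfolding asymp_real_iff_tendsto R_def[symmetric]
    proof (rule tendstoI)
      fix e :: real
      assume "e > 0"
      then have "e / (1 + 1 / (\<alpha> + \<beta>)) > 0"
        using s by (simp add: add_pos_pos)
      from uniform_limitD[OF U this] obtain N0 where
        N0: "\<And>N x. N \<ge> N0 \<Longrightarrow> x \<in> {1..2} \<Longrightarrow>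
          dist (interp \<alpha> \<beta> f (2 ^ N * x) / (\<alpha> + \<beta>) ^ N) (x powr rho \<alpha> \<beta> * P (log 2 x))
            < e / (1 + 1 / (\<alpha> + \<beta>))"
        unfolding eventually_sequentially by blast
      show "\<forall>\<^sub>F x in at_top. dist (R x) 0 < e"
        \<comment> \<open>With this threshold, \<open>2 ^ Suc N0 \<le> x < 2 ^ Suc N\<close> yields
          \<open>N \<ge> N0\<close>.\<close>
        using eventually_ge_at_top[of "2 ^ Suc N0 :: real"]
      proof eventually_elim
        case (elim x)
        have "(1::real) \<le> 2 ^ Suc N0"
          by (rule one_le_power) simp
        with elim have "x \<ge> 1"
          by linarith
        then obtain N y where Ny: "x = 2 ^ N * y" "1 \<le> y" "y < 2" "2 ^ Suc N > x"
          by (rule dyadic_decomp_ge1)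
        with elim have "(2::real) ^ Suc N0 < 2 ^ Suc N"
          by linarith
        then have "N \<ge> N0"
          by (simp only: power_strict_increasing_iff)
        then have "y powr rho \<alpha> \<beta> * \<bar>R x\<bar> < e / (1 + 1 / (\<alpha> + \<beta>))"
          using N0[of N y] Ny by (simp add: dist_real_def eq abs_mult)
        then have "y powr (- rho \<alpha> \<beta>) * (y powr rho \<alpha> \<beta> * \<bar>R x\<bar>)
            < (1 + 1 / (\<alpha> + \<beta>)) * (e / (1 + 1 / (\<alpha> + \<beta>)))"
          using powr_rho_bounds(2)[of y] Ny s
          by (intro mult_le_less_imp_less) auto
        moreover have "y powr (- rho \<alpha> \<beta>) * (y powr rho \<alpha> \<beta> * \<bar>R x\<bar>) = \<bar>R x\<bar>"
          using Ny by (simp add: powr_minus)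
        moreover have "1 + 1 / (\<alpha> + \<beta>) \<noteq> 0"
          using s by (simp add: add_pos_pos order.strict_implies_not_eq[symmetric])
        ultimately show ?case
          by simp
      qed
    qed
  qed
qed

text \<open>At \<open>x = 2 powr frac t\<close> the same rescaled sequence converges to both
  candidate values; periodicity extends the equality from \<open>frac t\<close> to
  \<open>t\<close>.\<close>

lemma asymp_real_unique:
  assumes P: "periodic1 P" "asymp_real \<alpha> \<beta> f P" and P': "periodic1 P'" "asymp_real \<alpha> \<beta> f P'"
  shows "P = P'"
proof
  fix t
  define x :: real where "x = 2 powr frac t"
  have "x \<ge> 2 powr 0" "x \<le> 2 powr 1"
    unfolding x_def using frac_lt_1[of t] frac_ge_0[of t] by (intro powr_mono; simp)+
  then have x: "x \<in> {1..2}"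
    by simp
  have "x powr rho \<alpha> \<beta> * P (log 2 x) = x powr rho \<alpha> \<beta> * P' (log 2 x)"
    using tendsto_uniform_limitI[OF P(2)[unfolded asymp_real_iff_uniform_limit[OF P(1)]] x]
      tendsto_uniform_limitI[OF P'(2)[unfolded asymp_real_iff_uniform_limit[OF P'(1)]] x]
    by (rule LIMSEQ_unique)
  then show "P t = P' t"
    using periodic1_frac[OF P(1), of t] periodic1_frac[OF P'(1), of t] by (simp add: x_def)
qed

text \<open>A uniform limit of continuous functions is continuous on \<open>[1,2]\<close>;
  substituting \<open>x = 2 powr t\<close> gives continuity of \<open>P\<close> on the closed
  interval \<open>[0,1]\<close>, and periodicity does the rest.\<close>

lemma asymp_real_imp_continuous:
  assumes P: "periodic1 P" "asymp_real \<alpha> \<beta> f P"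
  shows "continuous_on UNIV P"
proof (rule periodic1_continuous_on_UNIV[OF P(1)])
  have "continuous_on {1..2} (\<lambda>x. x powr rho \<alpha> \<beta> * P (log 2 x))"
  proof (rule uniform_limit_theorem[OF _ P(2)[unfolded asymp_real_iff_uniform_limit[OF P(1)]]])
    show "\<forall>\<^sub>F N in sequentially.
        continuous_on {1..2} (\<lambda>x. interp \<alpha> \<beta> f (2 ^ N * x) / (\<alpha> + \<beta>) ^ N)"
      using \<alpha>_pos \<beta>_pos
      by (intro always_eventually allI continuous_intros
          continuous_on_compose2[OF continuous_on_interp]) auto
  qed simp
  then have "continuous_on {0..1}
      (\<lambda>t. (2 powr t) powr rho \<alpha> \<beta> * P (log 2 (2 powr t)))"
  proof (rule continuous_on_compose2)
    show "(\<lambda>t. 2 powr t) ` {0..1} \<subseteq> {1..2::real}"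
      using powr_mono[of _ 1 "2::real"] by (auto simp: ge_one_powr_ge_zero)
  qed (intro continuous_intros; simp)
  \<comment> \<open>The new factor cancels \<open>(2 powr t) powr rho\<close> and leaves
    \<open>P\<close> alone.\<close>
  then have "continuous_on {0..1}
      (\<lambda>t. 2 powr (- t * rho \<alpha> \<beta>) * ((2 powr t) powr rho \<alpha> \<beta> * P (log 2 (2 powr t))))"
    by (rule continuous_on_mult[rotated]) (intro continuous_intros; simp)
  then show "continuous_on {0..1} P"
    by (rule continuous_on_eq) (simp add: powr_powr powr_minus)
qed

end

section \<open>The recurrence\<close>

locale divide_and_conquer =
  fixes \<alpha> \<beta> :: real and f g :: "nat \<Rightarrow> real"
  assumes \<alpha>_pos: "\<alpha> > 0" and \<beta>_pos: "\<beta> > 0" and g_1: "g 1 = 0"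
    and f_rec: "\<And>n. n \<ge> 2 \<Longrightarrow>
           f n = \<alpha> * f (nat \<lfloor>real n / 2\<rfloor>) + \<beta> * f (nat \<lceil>real n / 2\<rceil>) + g n"
begin

lemmas pos = \<alpha>_pos \<beta>_pos

lemma s_pos: "\<alpha> + \<beta> > 0"
  using pos by simp

lemma f_even: "n \<ge> 1 \<Longrightarrow> f (2 * n) = (\<alpha> + \<beta>) * f n + g (2 * n)"
  using f_rec[of "2 * n"] by (simp add: algebra_simps)

lemma f_odd:
  assumes "n \<ge> 1"
  shows "f (Suc (2 * n)) = \<alpha> * f n + \<beta> * f (Suc n) + g (Suc (2 * n))"
proof -
  have "\<lfloor>real (Suc (2 * n)) / 2\<rfloor> = int n" "\<lceil>real (Suc (2 * n)) / 2\<rceil> = int (Suc n)"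
    by (simp_all add: floor_eq_iff ceiling_eq_iff)
  then show ?thesis
    using f_rec[of "Suc (2 * n)"] assms by (simp only: nat_int)
qed

text \<open>For \<open>x = n + t\<close>, the value at \<open>2 * x\<close> interpolates between
  \<open>2 * n\<close> and its successor if \<open>t \<le> 1/2\<close>, and over the next unit
  interval otherwise. After expanding by the recurrence, the coefficient of
  \<open>f (Suc n) - f n\<close> is \<beta> \<open>phi (2 * t)\<close>, respectively \<alpha>
  \<open>phi (2 * t - 1)\<close> + \<beta>; the functional equations of \<open>phi\<close> make this
  (\<alpha> + \<beta>) \<open>phi t\<close>.\<close>

lemma interp_double:
  assumes "x \<ge> 1"
  shows "interp \<alpha> \<beta> f (2 * x) = (\<alpha> + \<beta>) * interp \<alpha> \<beta> f x + interp0 \<alpha> \<beta> g (2 * x)"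
proof -
  define n where "n = nat \<lfloor>x\<rfloor>"
  define t where "t = frac x"
  have n: "n \<ge> 1"
    using assms by (simp add: n_def le_nat_iff le_floor_iff)
  have t: "0 \<le> t" "t < 1"
    by (simp_all add: t_def frac_lt_1)
  have x: "x = real n + t"
    using assms by (simp add: n_def t_def frac_def)
  have fx: "interp \<alpha> \<beta> f x = (1 - phi \<alpha> \<beta> t) * f n + phi \<alpha> \<beta> t * f (Suc n)"
    unfolding x using t by (intro interp_add[OF pos]) auto
  have g0: "interp0 \<alpha> \<beta> g (2 * x) = interp \<alpha> \<beta> g (2 * x)"
    using assms by (simp add: interp0_def)
  show ?thesis
  proof (cases "t \<le> 1/2")
    case True
    have 2: "2 * x = real (2 * n) + 2 * t"
      by (simp add: x)
    have "interp \<alpha> \<beta> h (2 * x)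
        = (1 - phi \<alpha> \<beta> (2 * t)) * h (2 * n) + phi \<alpha> \<beta> (2 * t) * h (Suc (2 * n))" for h
      unfolding 2 using t True by (intro interp_add[OF pos]) auto
    moreover have "(\<alpha> + \<beta>) * interp \<alpha> \<beta> f x
        = (\<alpha> + \<beta>) * f n + ((\<alpha> + \<beta>) * phi \<alpha> \<beta> t) * (f (Suc n) - f n)"
      unfolding fx by (simp add: algebra_simps)
    moreover have "(\<alpha> + \<beta>) * phi \<alpha> \<beta> t = \<beta> * phi \<alpha> \<beta> (2 * t)"
      using t True by (intro phi_lower_half[OF pos]) auto
    ultimately show ?thesis
      unfolding g0 by (simp only: f_even[OF n] f_odd[OF n]) (simp add: algebra_simps)
  next
    case False
    have 2: "2 * x = real (Suc (2 * n)) + (2 * t - 1)"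
      by (simp add: x)
    have "interp \<alpha> \<beta> h (2 * x)
        = (1 - phi \<alpha> \<beta> (2 * t - 1)) * h (Suc (2 * n))
          + phi \<alpha> \<beta> (2 * t - 1) * h (2 * Suc n)" for h
      unfolding 2 using t False
      by (subst interp_add[OF pos]) auto
    moreover have "(\<alpha> + \<beta>) * interp \<alpha> \<beta> f x
        = (\<alpha> + \<beta>) * f n + ((\<alpha> + \<beta>) * phi \<alpha> \<beta> t) * (f (Suc n) - f n)"
      unfolding fx by (simp add: algebra_simps)
    moreover have "(\<alpha> + \<beta>) * phi \<alpha> \<beta> t = \<alpha> * phi \<alpha> \<beta> (2 * t - 1) + \<beta>"
      using t False by (intro phi_upper_half[OF pos]) auto
    moreover have "f (2 * Suc n) = (\<alpha> + \<beta>) * f (Suc n) + g (2 * Suc n)"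
      by (rule f_even) simp
    ultimately show ?thesis
      unfolding g0 by (simp only: f_odd[OF n]) (simp add: algebra_simps)
  qed
qed

section \<open>Rescaled solutions and partial sums of \<open>Q\<close>\<close>

lemma Q_term_eq: "Q_term \<alpha> \<beta> g x m = interp0 \<alpha> \<beta> g (2 ^ m * x) / (\<alpha> + \<beta>) ^ m"
  unfolding Q_term_def two_powr_rho_of_nat[OF pos] by simp

lemma Q_term_double: "Q_term \<alpha> \<beta> g (2 * x) m = (\<alpha> + \<beta>) * Q_term \<alpha> \<beta> g x (Suc m)"
  using s_pos by (simp add: Q_term_eq mult_ac)

text \<open>Dividing the doubling equation at \<open>2 ^ N * x\<close> by the next power of \<alpha>
  + \<beta> shows that each step adds one term of the series.\<close>

lemma interp_scaled:
  assumes "x \<ge> 1"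
  shows "interp \<alpha> \<beta> f (2 ^ N * x) / (\<alpha> + \<beta>) ^ N
    = interp \<alpha> \<beta> f x + (\<Sum>m=1..N. Q_term \<alpha> \<beta> g x m)"
proof (induction N)
  case (Suc N)
  have "(1::real) * 1 \<le> 2 ^ N * x"
    using assms by (intro mult_mono) auto
  then have "interp \<alpha> \<beta> f (2 ^ Suc N * x)
      = (\<alpha> + \<beta>) * interp \<alpha> \<beta> f (2 ^ N * x) + interp0 \<alpha> \<beta> g (2 ^ Suc N * x)"
    using interp_double[of "2 ^ N * x"] by (simp add: mult.assoc)
  then have "interp \<alpha> \<beta> f (2 ^ Suc N * x) / (\<alpha> + \<beta>) ^ Suc N
      = interp \<alpha> \<beta> f (2 ^ N * x) / (\<alpha> + \<beta>) ^ N + Q_term \<alpha> \<beta> g x (Suc N)"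
    using s_pos by (simp add: Q_term_eq add_divide_distrib)
  with Suc show ?case
    by simp
qed simp

text \<open>On \<open>[1,2]\<close> only \<open>f 1\<close> and \<open>f 2\<close> enter, and the
  recurrence reduces \<open>f 2\<close> to \<open>f 1\<close>. The factor of \<open>f 1\<close> is
  the source of \<open>P0\<close>.\<close>

lemma interp_initial:
  assumes "x \<in> {1..2}"
  shows "interp \<alpha> \<beta> f x = f 1 * (1 + (\<alpha> + \<beta> - 1) * phi \<alpha> \<beta> (x - 1)) + interp0 \<alpha> \<beta> g x"
proof -
  have "interp \<alpha> \<beta> h x = (1 - phi \<alpha> \<beta> (x - 1)) * h 1 + phi \<alpha> \<beta> (x - 1) * h 2" for h
    using interp_add[OF pos, of "x - 1" h 1] assms by (simp add: numeral_2_eq_2)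
  moreover have "f 2 = (\<alpha> + \<beta>) * f 1 + g 2"
    using f_even[of 1] by simp
  moreover have "interp0 \<alpha> \<beta> g x = interp \<alpha> \<beta> g x"
    using assms by (simp add: interp0_def)
  ultimately show ?thesis
    \<comment> \<open>Since \<open>g 1 = 0\<close>, the interpolated \<open>g\<close> at
      \<open>x\<close> is just \<open>phi (x - 1) * g 2\<close>.\<close>
    by (simp only: g_1) (simp add: algebra_simps)
qed

text \<open>The partial sums differ from the rescaled solutions by \<open>interp f\<close>, which
  does not depend on \<open>N\<close>.\<close>

lemma asymp_real_imp_uniformly_convergent:
  assumes "periodic1 P" "asymp_real \<alpha> \<beta> f P"
  shows "uniformly_convergent_on {1..2} (\<lambda>N x. \<Sum>m=1..N. Q_term \<alpha> \<beta> g x m)"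
proof -
  have "uniform_limit {1..2}
      (\<lambda>N x. interp \<alpha> \<beta> f (2 ^ N * x) / (\<alpha> + \<beta>) ^ N - interp \<alpha> \<beta> f x)
      (\<lambda>x. x powr rho \<alpha> \<beta> * P (log 2 x) - interp \<alpha> \<beta> f x) sequentially"
    using assms asymp_real_iff_uniform_limit[OF pos] by (intro uniform_limit_intros) auto
  then have "uniform_limit {1..2} (\<lambda>N x. \<Sum>m=1..N. Q_term \<alpha> \<beta> g x m)
      (\<lambda>x. x powr rho \<alpha> \<beta> * P (log 2 x) - interp \<alpha> \<beta> f x) sequentially"
    by (rule uniform_limit_cong'[THEN iffD1, rotated -1]) (auto simp: interp_scaled)
  then show ?thesis
    unfolding uniformly_convergent_on_def by blast
qed

end

section \<open>Consequences of uniform convergence of the series\<close>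

locale divide_and_conquer_convergent = divide_and_conquer +
  assumes uconv: "uniformly_convergent_on {1..2} (\<lambda>N x. \<Sum>m=1..N. Q_term \<alpha> \<beta> g x m)"
begin

lemma sum_Q_term: "(\<Sum>m=1..N. Q_term \<alpha> \<beta> g x m) = (\<Sum>m<N. Q_term \<alpha> \<beta> g x (Suc m))"
  by (rule sum.reindex_bij_witness[of _ Suc "\<lambda>m. m - 1"]) auto

text \<open>Uniform convergence supplies some limit function; pointwise it can only be the sum of
  the series.\<close>

lemma uniform_limit_Q:
  "uniform_limit {1..2} (\<lambda>N x. \<Sum>m=1..N. Q_term \<alpha> \<beta> g x m) (Q \<alpha> \<beta> g) sequentially"
proof -
  from uconv obtain l where
    l: "uniform_limit {1..2} (\<lambda>N x. \<Sum>m=1..N. Q_term \<alpha> \<beta> g x m) l sequentially"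
    unfolding uniformly_convergent_on_def by blast
  have "l x = Q \<alpha> \<beta> g x" if "x \<in> {1..2}" for x
  proof -
    have "(\<lambda>m. Q_term \<alpha> \<beta> g x (Suc m)) sums l x"
      using tendsto_uniform_limitI[OF l that] unfolding sums_def sum_Q_term .
    then show ?thesis
      unfolding Q_def by (rule sums_unique)
  qed
  with l show ?thesis
    by (subst uniform_limit_cong'[where h = "Q \<alpha> \<beta> g" and i = l, OF refl]) simp_all
qed

text \<open>Doubling \<open>x\<close> drops the first term and multiplies the others by \<alpha> +
  \<beta>. Convergence thus spreads from \<open>[1,2]\<close> to all positive arguments, upwards and
  downwards.\<close>

lemma summable_Q_double_iff:
  "summable (\<lambda>m. Q_term \<alpha> \<beta> g (2 * x) (Suc m)) \<longleftrightarrow> summable (\<lambda>m. Q_term \<alpha> \<beta> g x (Suc m))"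
proof -
  have "summable (\<lambda>m. Q_term \<alpha> \<beta> g (2 * x) (Suc m))
      \<longleftrightarrow> summable (\<lambda>m. Q_term \<alpha> \<beta> g x (Suc (Suc m)))"
    unfolding Q_term_double using s_pos by (simp add: summable_cmult_iff)
  then show ?thesis
    by (simp only: summable_Suc_iff[of "\<lambda>m. Q_term \<alpha> \<beta> g x (Suc m)"])
qed

lemma summable_Q_scaled_iff:
  "summable (\<lambda>m. Q_term \<alpha> \<beta> g (2 ^ N * x) (Suc m)) \<longleftrightarrow> summable (\<lambda>m. Q_term \<alpha> \<beta> g x (Suc m))"
proof (induction N)
  case (Suc N)
  then show ?case
    using summable_Q_double_iff[of "2 ^ N * x"] by (simp add: mult.assoc)
qed simp

lemma summable_Q:
  assumes "x > 0"
  shows "summable (\<lambda>m. Q_term \<alpha> \<beta> g x (Suc m))"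
proof -
  have *: "summable (\<lambda>m. Q_term \<alpha> \<beta> g y (Suc m))" if "y \<in> {1..2}" for y
    using tendsto_uniform_limitI[OF uniform_limit_Q that]
    unfolding sum_Q_term sums_def[symmetric] by (rule sums_summable)
  show ?thesis
  proof (cases "x \<ge> 1")
    case True
    then obtain N y where "x = 2 ^ N * y" "1 \<le> y" "y < 2"
      by (rule dyadic_decomp_ge1)
    then show ?thesis
      using * by (simp add: summable_Q_scaled_iff)
  next
    case False
    with assms obtain N y where "y = 2 ^ N * x" "1 \<le> y" "y < 2"
      using dyadic_decomp_lt1[of x] by (metis not_le)
    then show ?thesis
      using *[of y] summable_Q_scaled_iff[of N x] by simp
  qed
qed

text \<open>The dropped term, multiplied by \<alpha> + \<beta>, is the value of \<open>g\<close> at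
  \<open>2 * x\<close>. It enters with the sign opposite to that in \<open>interp_double\<close>, so
  it cancels in the sum of \<open>f\<close> and \<open>Q\<close>.\<close>

lemma Q_double:
  assumes "x > 0"
  shows "Q \<alpha> \<beta> g (2 * x) = (\<alpha> + \<beta>) * Q \<alpha> \<beta> g x - interp0 \<alpha> \<beta> g (2 * x)"
proof -
  have "Q \<alpha> \<beta> g (2 * x) = (\<alpha> + \<beta>) * (\<Sum>m. Q_term \<alpha> \<beta> g x (Suc (Suc m)))"
    unfolding Q_def Q_term_double
    using summable_Q[OF assms, THEN summable_Suc_iff[THEN iffD2]] by (rule suminf_mult)
  also have "(\<Sum>m. Q_term \<alpha> \<beta> g x (Suc (Suc m))) = Q \<alpha> \<beta> g x - Q_term \<alpha> \<beta> g x 1"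
    unfolding Q_def using suminf_split_head[OF summable_Q[OF assms]] by simp
  finally show ?thesis
    using s_pos by (simp add: Q_term_eq right_diff_distrib)
qed

lemma interp_plus_Q_scaled:
  assumes "x \<ge> 1"
  shows "interp \<alpha> \<beta> f (2 ^ N * x) + Q \<alpha> \<beta> g (2 ^ N * x)
    = (\<alpha> + \<beta>) ^ N * (interp \<alpha> \<beta> f x + Q \<alpha> \<beta> g x)"
proof (induction N)
  case (Suc N)
  have "(1::real) * 1 \<le> 2 ^ N * x"
    using assms by (intro mult_mono) auto
  then have "interp \<alpha> \<beta> f (2 * (2 ^ N * x)) + Q \<alpha> \<beta> g (2 * (2 ^ N * x))
      = (\<alpha> + \<beta>) * (interp \<alpha> \<beta> f (2 ^ N * x) + Q \<alpha> \<beta> g (2 ^ N * x))"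
    by (subst interp_double, simp, subst Q_double, simp) (simp add: algebra_simps)
  with Suc show ?case
    by (simp add: mult.assoc)
qed simp

section \<open>The two-sided series for \<open>P\<close>\<close>

lemma P_term_of_nat:
  "P_term \<alpha> \<beta> g t (int m) = 2 powr (- rho \<alpha> \<beta> * t) * Q_term \<alpha> \<beta> g (2 powr t) m"
proof -
  have "2 powr (of_int (int m) + t) = 2 ^ m * 2 powr t"
    by (simp add: powr_add powr_realpow)
  moreover have "2 powr (- rho \<alpha> \<beta> * (of_int (int m) + t))
      = 2 powr (- rho \<alpha> \<beta> * t) * 2 powr (- rho \<alpha> \<beta> * real m)"
    unfolding powr_add[symmetric] by (simp add: algebra_simps)
  ultimately show ?thesis
    unfolding P_term_def Q_term_def by (simp only: mult.assoc)
qed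

text \<open>The argument of \<open>g\<close> is below 1, where its extension is 0 by convention; so
  the negative half of the series is a finite sum.\<close>

lemma P_term_neg:
  assumes "t < real (Suc m)"
  shows "P_term \<alpha> \<beta> g t (- int (Suc m)) = 0"
proof -
  have "2 powr (of_int (- int (Suc m)) + t) < (2::real) powr 0"
    using assms by (intro powr_less_mono) auto
  then show ?thesis
    by (simp add: P_term_def interp0_def)
qed

lemma bi_summable_P_term: "bi_summable (P_term \<alpha> \<beta> g t)"
  unfolding bi_summable_def
proof
  have "summable (Q_term \<alpha> \<beta> g (2 powr t))"
    using summable_Suc_iff summable_Q[of "2 powr t"] by auto
  then show "summable (\<lambda>m. P_term \<alpha> \<beta> g t (int m))"
    unfolding P_term_of_nat by (rule summable_mult)
  show "summable (\<lambda>m. P_term \<alpha> \<beta> g t (- int (Suc m)))"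
  proof (rule summable_finite[of "{..nat \<lceil>t\<rceil>}"])
    fix m
    assume "m \<notin> {..nat \<lceil>t\<rceil>}"
    then have "t < real (Suc m)"
      by (simp, linarith)
    then show "P_term \<alpha> \<beta> g t (- int (Suc m)) = 0"
      by (rule P_term_neg)
  qed simp
qed

text \<open>Increasing \<open>t\<close> by 1 shifts the index of the two-sided series by 1, and
  \<open>P0\<close> depends only on \<open>frac t\<close>.\<close>

lemma periodic1_P_lim: "periodic1 (P_lim \<alpha> \<beta> f g)"
  unfolding periodic1_def
proof
  fix t
  have "P_term \<alpha> \<beta> g (t + 1) = (\<lambda>m. P_term \<alpha> \<beta> g t (m + 1))"
    by (simp add: P_term_def fun_eq_iff add_ac)
  moreover have "P0 \<alpha> \<beta> (t + 1) = P0 \<alpha> \<beta> t"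
    by (simp add: P0_def frac_1_eq)
  ultimately show "P_lim \<alpha> \<beta> f g (t + 1) = P_lim \<alpha> \<beta> f g t"
    using bi_suminf_shift[OF bi_summable_P_term] by (simp add: P_lim_def)
qed

text \<open>For such \<open>t\<close> the negative half vanishes. With \<open>x = 2 powr t\<close>,
  the nonnegative half contributes \<open>g\<close> and \<open>Q\<close> at \<open>x\<close>, and
  \<open>interp_initial\<close> combines this \<open>g\<close> with the \<open>P0\<close> term into
  \<open>f\<close> at \<open>x\<close>.\<close>

lemma P_lim_on_unit:
  assumes "0 \<le> t" "t < 1"
  shows "P_lim \<alpha> \<beta> f g t
    = 2 powr (- rho \<alpha> \<beta> * t) * (interp \<alpha> \<beta> f (2 powr t) + Q \<alpha> \<beta> g (2 powr t))"
proof -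
  define x :: real where "x = 2 powr t"
  have "x \<ge> 2 powr 0" "x \<le> 2 powr 1"
    unfolding x_def using assms by (intro powr_mono; simp)+
  then have x: "x \<in> {1..2}"
    by simp
  have "(\<Sum>m. P_term \<alpha> \<beta> g t (- int (Suc m))) = (\<Sum>m::nat. 0)"
    using assms by (intro suminf_cong P_term_neg) simp
  moreover have "(\<Sum>m. P_term \<alpha> \<beta> g t (int m))
      = 2 powr (- rho \<alpha> \<beta> * t) * (interp0 \<alpha> \<beta> g x + Q \<alpha> \<beta> g x)"
  proof -
    have Q: "summable (Q_term \<alpha> \<beta> g x)"
      using summable_Suc_iff summable_Q[of x] x by auto
    then have "(\<Sum>m. P_term \<alpha> \<beta> g t (int m)) = 2 powr (- rho \<alpha> \<beta> * t) * suminf (Q_term \<alpha> \<beta> g x)"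
      unfolding P_term_of_nat x_def by (rule suminf_mult)
    \<comment> \<open>The two-sided series includes the index 0, whereas \<open>Q\<close> starts at
      1.\<close>
    also have "suminf (Q_term \<alpha> \<beta> g x) = interp0 \<alpha> \<beta> g x + Q \<alpha> \<beta> g x"
      using suminf_split_head[OF Q] by (simp add: Q_def Q_term_eq)
    finally show ?thesis .
  qed
  moreover have "P0 \<alpha> \<beta> t
      = 2 powr (- rho \<alpha> \<beta> * t) * (1 + (\<alpha> + \<beta> - 1) * phi \<alpha> \<beta> (x - 1))"
  proof -
    have "(\<alpha> + \<beta>) powr (- t) = 2 powr (- rho \<alpha> \<beta> * t)"
      unfolding two_powr_rho[OF pos, symmetric] by (simp add: powr_powr)
    moreover have "frac t = t"
      using assms by (simp add: frac_eq)
    ultimately show ?thesis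
      by (simp add: P0_def x_def)
  qed
  ultimately show ?thesis
    unfolding P_lim_def bi_suminf_def x_def[symmetric] interp_initial[OF x]
    by (simp only:) (simp add: algebra_simps)
qed

text \<open>Replacing \<open>x\<close> by \<open>2 ^ N * x\<close> multiplies both sides by the
  \<open>N\<close>-th power of \<alpha> + \<beta>, so the formula on \<open>[1,2)\<close> determines
  it everywhere.\<close>

lemma interp_plus_Q_eq:
  assumes "x \<ge> 1"
  shows "interp \<alpha> \<beta> f x + Q \<alpha> \<beta> g x = x powr rho \<alpha> \<beta> * P_lim \<alpha> \<beta> f g (log 2 x)"
proof -
  obtain N y where Ny: "x = 2 ^ N * y" "1 \<le> y" "y < 2"
    using assms by (rule dyadic_decomp_ge1)
  have "P_lim \<alpha> \<beta> f g (log 2 y)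
      = 2 powr (- rho \<alpha> \<beta> * log 2 y) * (interp \<alpha> \<beta> f y + Q \<alpha> \<beta> g y)"
    using P_lim_on_unit[of "log 2 y"] Ny by simp
  moreover have "2 powr (- rho \<alpha> \<beta> * log 2 y) = y powr (- rho \<alpha> \<beta>)"
    using Ny powr_powr[of 2 "log 2 y" "- rho \<alpha> \<beta>"] by (simp add: mult.commute)
  ultimately have "interp \<alpha> \<beta> f y + Q \<alpha> \<beta> g y = y powr rho \<alpha> \<beta> * P_lim \<alpha> \<beta> f g (log 2 y)"
    using Ny by (simp add: powr_minus)
  then show ?thesis
    using Ny by (simp add: interp_plus_Q_scaled scaled_powr_rho[OF pos]
        log2_scaled periodic1_add_nat[OF periodic1_P_lim])
qed

lemma asymp_real_P_lim: "asymp_real \<alpha> \<beta> f (P_lim \<alpha> \<beta> f g)"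
proof -
  have "uniform_limit {1..2} (\<lambda>N x. interp \<alpha> \<beta> f x + (\<Sum>m=1..N. Q_term \<alpha> \<beta> g x m))
      (\<lambda>x. interp \<alpha> \<beta> f x + Q \<alpha> \<beta> g x) sequentially"
    by (rule uniform_limit_add[OF uniform_limit_const uniform_limit_Q])
  then have "uniform_limit {1..2} (\<lambda>N x. interp \<alpha> \<beta> f (2 ^ N * x) / (\<alpha> + \<beta>) ^ N)
      (\<lambda>x. x powr rho \<alpha> \<beta> * P_lim \<alpha> \<beta> f g (log 2 x)) sequentially"
    by (rule uniform_limit_cong'[THEN iffD1, rotated -1])
      (simp_all add: interp_scaled interp_plus_Q_eq)
  then show ?thesis
    by (simp only: asymp_real_iff_uniform_limit[OF pos periodic1_P_lim])
qed

text \<open>By the exact formula, \<open>Q\<close> divided by \<open>x powr rho\<close> is the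
  negative of the error term of the asymptotic relation.\<close>

lemma Q_smallo: "Q \<alpha> \<beta> g \<in> o[at_top](\<lambda>x. x powr rho \<alpha> \<beta>)"
proof (rule smalloI_tendsto)
  have "((\<lambda>x. - (x powr (- rho \<alpha> \<beta>) * interp \<alpha> \<beta> f x - P_lim \<alpha> \<beta> f g (log 2 x)))
      \<longlongrightarrow> - 0) at_top"
    using asymp_real_P_lim unfolding asymp_real_iff_tendsto by (rule tendsto_minus)
  moreover have "\<forall>\<^sub>F x in at_top.
      - (x powr (- rho \<alpha> \<beta>) * interp \<alpha> \<beta> f x - P_lim \<alpha> \<beta> f g (log 2 x))
      = Q \<alpha> \<beta> g x / x powr rho \<alpha> \<beta>"
    using eventually_ge_at_top[of "1::real"]
  proof eventually_elim
    case (elim x)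
    then have "Q \<alpha> \<beta> g x = x powr rho \<alpha> \<beta> * P_lim \<alpha> \<beta> f g (log 2 x) - interp \<alpha> \<beta> f x"
      using interp_plus_Q_eq[of x] by simp
    with elim show ?case
      by (simp add: powr_minus diff_divide_distrib divide_inverse[symmetric] mult.commute
          inverse_eq_divide)
  qed
  ultimately show "((\<lambda>x. Q \<alpha> \<beta> g x / x powr rho \<alpha> \<beta>) \<longlongrightarrow> 0) at_top"
    by (simp add: tendsto_cong)
  show "\<forall>\<^sub>F x in at_top. x powr rho \<alpha> \<beta> \<noteq> 0"
    using eventually_gt_at_top[of "0::real"] by eventually_elim simp
qed

end

theorem theorem2p10:
  fixes \<alpha> \<beta> :: real and f g :: "nat \<Rightarrow> real"
  assumes "\<alpha> > 0" and "\<beta> > 0"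
    and "g 1 = 0"
    and "\<And>n. n \<ge> 2 \<Longrightarrow>
           f n = \<alpha> * f (nat \<lfloor>real n / 2\<rfloor>) + \<beta> * f (nat \<lceil>real n / 2\<rceil>) + g n"
  shows
    "((\<exists>P. continuous_on UNIV P \<and> periodic1 P \<and> asymp_nat \<alpha> \<beta> f P) \<longleftrightarrow>
      (\<exists>P. continuous_on UNIV P \<and> periodic1 P \<and> asymp_real \<alpha> \<beta> f P)) \<and>
     ((\<exists>P. continuous_on UNIV P \<and> periodic1 P \<and> asymp_real \<alpha> \<beta> f P) \<longleftrightarrow>
      (\<exists>P. periodic1 P \<and> asymp_real \<alpha> \<beta> f P)) \<and>
     ((\<exists>P. periodic1 P \<and> asymp_real \<alpha> \<beta> f P) \<longleftrightarrow>
      uniformly_convergent_on {1..2} (\<lambda>N x. \<Sum>m=1..N. Q_term \<alpha> \<beta> g x m)) \<and>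
     (uniformly_convergent_on {1..2} (\<lambda>N x. \<Sum>m=1..N. Q_term \<alpha> \<beta> g x m) \<longrightarrow>
        (\<forall>x>0. summable (\<lambda>m. Q_term \<alpha> \<beta> g x (Suc m))) \<and>
        Q \<alpha> \<beta> g \<in> o[at_top](\<lambda>x. x powr rho \<alpha> \<beta>) \<and>
        (\<forall>t. bi_summable (P_term \<alpha> \<beta> g t)) \<and>
        continuous_on UNIV (P_lim \<alpha> \<beta> f g) \<and> periodic1 (P_lim \<alpha> \<beta> f g) \<and>
        (\<forall>x\<ge>1. interp \<alpha> \<beta> f x = x powr rho \<alpha> \<beta> * P_lim \<alpha> \<beta> f g (log 2 x) - Q \<alpha> \<beta> g x) \<and>
        (\<forall>P. periodic1 P \<and> (continuous_on UNIV P \<and> asymp_nat \<alpha> \<beta> f P \<or> asymp_real \<alpha> \<beta> f P)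
              \<longrightarrow> P = P_lim \<alpha> \<beta> f g))"
proof -
  interpret divide_and_conquer \<alpha> \<beta> f g
    using assms by unfold_locales
  let ?iv = "uniformly_convergent_on {1..2} (\<lambda>N x. \<Sum>m=1..N. Q_term \<alpha> \<beta> g x m)"
  \<comment> \<open>The equivalence holds for each \<open>P\<close> separately, so uniqueness can
    later be transferred from the reals to the integers.\<close>
  have i_ii: "asymp_nat \<alpha> \<beta> f P \<longleftrightarrow> asymp_real \<alpha> \<beta> f P"
    if "continuous_on UNIV P" "periodic1 P" for P
    using that asymp_nat_imp_asymp_real[OF pos] asymp_real_imp_asymp_nat[OF pos] by blast
  have iii_ii: "continuous_on UNIV P" if "periodic1 P" "asymp_real \<alpha> \<beta> f P" for P
    using that by (rule asymp_real_imp_continuous[OF pos])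
  have iii_iv: ?iv if "periodic1 P" "asymp_real \<alpha> \<beta> f P" for P
    using that by (rule asymp_real_imp_uniformly_convergent)
  have iv_iii: "periodic1 (P_lim \<alpha> \<beta> f g) \<and> asymp_real \<alpha> \<beta> f (P_lim \<alpha> \<beta> f g)" if ?iv
  proof -
    interpret divide_and_conquer_convergent \<alpha> \<beta> f g
      using that by unfold_locales
    show ?thesis
      using periodic1_P_lim asymp_real_P_lim by (rule conjI)
  qed
  show ?thesis
  proof (intro conjI impI)
    show "(\<exists>P. continuous_on UNIV P \<and> periodic1 P \<and> asymp_nat \<alpha> \<beta> f P) \<longleftrightarrow>
      (\<exists>P. continuous_on UNIV P \<and> periodic1 P \<and> asymp_real \<alpha> \<beta> f P)"
      using i_ii by metis
    show "(\<exists>P. continuous_on UNIV P \<and> periodic1 P \<and> asymp_real \<alpha> \<beta> f P) \<longleftrightarrow>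
      (\<exists>P. periodic1 P \<and> asymp_real \<alpha> \<beta> f P)"
      using iii_ii by metis
    show "(\<exists>P. periodic1 P \<and> asymp_real \<alpha> \<beta> f P) \<longleftrightarrow> ?iv"
      using iii_iv iv_iii by metis
  next
    assume ?iv
    then interpret divide_and_conquer_convergent \<alpha> \<beta> f g
      by unfold_locales
    show "\<forall>x>0. summable (\<lambda>m. Q_term \<alpha> \<beta> g x (Suc m))"
      by (intro allI impI summable_Q)
    show "Q \<alpha> \<beta> g \<in> o[at_top](\<lambda>x. x powr rho \<alpha> \<beta>)"
      by (rule Q_smallo)
    show "\<forall>t. bi_summable (P_term \<alpha> \<beta> g t)"
      by (intro allI bi_summable_P_term)
    show "continuous_on UNIV (P_lim \<alpha> \<beta> f g)"
      \<comment> \<open>Continuity is not read off the series but inherited from the asymptotic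
        relation.\<close>
      using periodic1_P_lim asymp_real_P_lim by (rule iii_ii)
    show "periodic1 (P_lim \<alpha> \<beta> f g)"
      by (rule periodic1_P_lim)
    show "\<forall>x\<ge>1. interp \<alpha> \<beta> f x = x powr rho \<alpha> \<beta> * P_lim \<alpha> \<beta> f g (log 2 x) - Q \<alpha> \<beta> g x"
      using interp_plus_Q_eq by (simp add: eq_diff_eq)
    \<comment> \<open>This identifies every \<open>P\<close> from (i), (ii) or (iii) with the
      explicit one. In the integer case continuity matters: the relation only sees \<open>P\<close>
      at the countably many points \<open>log 2 n\<close> modulo 1.\<close>
    show "\<forall>P. periodic1 P \<and> (continuous_on UNIV P \<and> asymp_nat \<alpha> \<beta> f P \<or> asymp_real \<alpha> \<beta> f P)
              \<longrightarrow> P = P_lim \<alpha> \<beta> f g"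
      using i_ii asymp_real_unique[OF pos _ _ periodic1_P_lim asymp_real_P_lim] by metis
  qed
qed

end
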